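(* Let $X$ be a complex Banach space, let $T\in\mathcal L(X)$, and let $\lambda\in\mathbb C$. Then the following are equivalent. (i) $\lambda\in W_e(T)$. (ii) There exists a net $(x_\alpha,x_\alpha^* )\subset X\times X^*$ such that $x_\alpha\to 0$ weakly in $X$, $\|x_\alpha\|\to 1$, $\|x_\alpha^*\|\to 1$, $\langle x_\alpha,x_\alpha^*\rangle\to 1$, and $\langle Tx_\alpha,x_\alpha^*\rangle\to\lambda$. (iii) For every subspace $M\subset X$ with $\operatorname{codim}M<\infty$ and every $\varepsilon>0$ there exists $(x,x^* )\in\Pi(X)$ with $x\in M$ and $|\langle Tx,x^*\rangle-\lambda|<\varepsilon$.
   Context: $\mathcal L(X)$ is the algebra of bounded linear operators on $X$, $X^*$ is the dual space, and $\langle x,x^*\rangle$ is the duality pairing (the value of $x^*$ at $x$). Finite-codimensional subspaces are understood to be closed. Put $\Pi(X):=\{(x,x^* )\in X\times X^*:\ \|x\|=\|x^*\|=1=\langle x,x^*\rangle\}$. The essential numerical range $W_e(T)$ of $T\in\mathcal L(X)$ is the set of all $\lambda\in\mathbb C$ for which there exists a net $(x_\alpha,x_\alpha^* )\subset\Pi(X)$ such that $x_\alpha\to0$ weakly and $\langle Tx_\alpha,x_\alpha^*\rangle\to\lambda$. *)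

theory Defs
  imports "HOL-Analysis.Analysis"
begin

section \<open>Complex Banach spaces\<close>

text \<open>
  The distribution only has real normed spaces as type classes. A complex normed space is a real
  one with a compatible complex scalar multiplication, so that topology, completeness and the
  type of bounded (real-)linear maps are inherited.
\<close>

class complex_normed_vector = real_normed_vector +
  fixes scaleC :: "complex \<Rightarrow> 'a \<Rightarrow> 'a" (infixr "*\<^sub>C" 75)
  assumes scaleC_add_right: "a *\<^sub>C (x + y) = a *\<^sub>C x + a *\<^sub>C y"
    and scaleC_add_left: "(a + b) *\<^sub>C x = a *\<^sub>C x + b *\<^sub>C x"
    and scaleC_scaleC: "a *\<^sub>C b *\<^sub>C x = (a * b) *\<^sub>C x"
    and scaleC_one: "1 *\<^sub>C x = x"
    and scaleR_scaleC: "r *\<^sub>R x = complex_of_real r *\<^sub>C x"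
    and norm_scaleC: "norm (a *\<^sub>C x) = cmod a * norm x"

class complex_banach = complex_normed_vector + banach

global_interpretation complex_vector:
  vector_space "scaleC :: complex \<Rightarrow> 'a \<Rightarrow> 'a::complex_normed_vector"
  by unfold_locales (fact scaleC_add_right scaleC_add_left scaleC_scaleC scaleC_one)+

instantiation complex :: complex_banach
begin

definition scaleC_complex :: "complex \<Rightarrow> complex \<Rightarrow> complex"
  where "scaleC_complex a x = a * x"

instance
  by standard (simp_all add: scaleC_complex_def algebra_simps norm_mult scaleR_conv_of_real)

end

text \<open>
  The complex-linear elements of \<open>'a \<Rightarrow>\<^sub>L 'b\<close>. The norm of that type is the operator norm
  \<open>sup {norm (f x) / norm x}\<close>, which does not depend on the scalar field.
\<close>

definition cblinfun :: "('a::complex_normed_vector \<Rightarrow>\<^sub>L 'b::complex_normed_vector) set"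
  where "cblinfun = {f. Vector_Spaces.linear scaleC scaleC (blinfun_apply f)}"

abbreviation dual_space :: "('a::complex_normed_vector \<Rightarrow>\<^sub>L complex) set"
  where "dual_space \<equiv> cblinfun"

definition weakly_tendsto ::
    "('i \<Rightarrow> 'a::complex_normed_vector) \<Rightarrow> 'a \<Rightarrow> 'i filter \<Rightarrow> bool"
  where "weakly_tendsto x l F \<longleftrightarrow>
    (\<forall>f\<in>dual_space. ((\<lambda>i. blinfun_apply f (x i)) \<longlongrightarrow> blinfun_apply f l) F)"

text \<open>
  Closed complex subspaces whose quotient is finite-dimensional: the classes of the elements of
  the finite set \<open>B\<close> span the quotient by \<open>M\<close>.
\<close>

definition finite_codim_subspace :: "'a::complex_normed_vector set \<Rightarrow> bool"
  where "finite_codim_subspace M \<longleftrightarrow>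
    complex_vector.subspace M \<and> closed M \<and>
    (\<exists>B. finite B \<and> complex_vector.span (M \<union> B) = UNIV)"


section \<open>Nets\<close>

definition directed_set :: "'i set \<Rightarrow> ('i \<Rightarrow> 'i \<Rightarrow> bool) \<Rightarrow> bool"
  where "directed_set D le \<longleftrightarrow> D \<noteq> {} \<and>
    (\<forall>i\<in>D. le i i) \<and>
    (\<forall>i\<in>D. \<forall>j\<in>D. \<forall>k\<in>D. le i j \<longrightarrow> le j k \<longrightarrow> le i k) \<and>
    (\<forall>i\<in>D. \<forall>j\<in>D. \<exists>k\<in>D. le i k \<and> le j k)"

text \<open>Convergence along the following filter is convergence of nets indexed by \<open>D\<close>.\<close>

definition tails :: "'i set \<Rightarrow> ('i \<Rightarrow> 'i \<Rightarrow> bool) \<Rightarrow> 'i filter"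
  where "tails D le = (INF i\<in>D. principal {j\<in>D. le i j})"

definition net_in :: "'i set \<Rightarrow> ('i \<Rightarrow> 'i \<Rightarrow> bool) \<Rightarrow> ('i \<Rightarrow> 'b) \<Rightarrow> 'b set \<Rightarrow> bool"
  where "net_in D le z S \<longleftrightarrow> directed_set D le \<and> (\<forall>i\<in>D. z i \<in> S)"

text \<open>
  HOL cannot quantify existentially over the index type of a net. For nets with values in
  \<open>'b\<close> the index type \<open>'b \<times> 'b set\<close> is large enough: by \<open>net_reindex\<close> below, every net over
  any index type has the same image filter as a net over this one, and the convergence
  conditions used here depend on the image filter only.
\<close>

type_synonym 'b net_index = "'b \<times> 'b set"

lemma eventually_tails:
  assumes "directed_set D le"
  shows "eventually P (tails D le) \<longleftrightarrow> (\<exists>i\<in>D. \<forall>j\<in>D. le i j \<longrightarrow> P j)"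
proof -
  have "eventually P (tails D le) \<longleftrightarrow> (\<exists>i\<in>D. eventually P (principal {j\<in>D. le i j}))"
    unfolding tails_def
  proof (rule eventually_INF_base)
    show "D \<noteq> {}" using assms by (simp add: directed_set_def)
    fix a b assume ab: "a \<in> D" "b \<in> D"
    then obtain k where k: "k \<in> D" "le a k" "le b k"
      using assms unfolding directed_set_def by meson
    have "{j\<in>D. le k j} \<subseteq> {j\<in>D. le a j} \<inter> {j\<in>D. le b j}"
      using assms ab k unfolding directed_set_def by blast
    then show "\<exists>x\<in>D. principal {j\<in>D. le x j} \<le>
        inf (principal {j\<in>D. le a j}) (principal {j\<in>D. le b j})"
      using k(1) by auto
  qed
  then show ?thesis by (auto simp: eventually_principal)
qed

lemma net_reindex:
  fixes z :: "'i \<Rightarrow> 'b"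
  assumes net: "net_in D le z S"
  shows "\<exists>(D' :: 'b net_index set) le' z'. net_in D' le' z' S \<and>
    filtermap z' (tails D' le') = filtermap z (tails D le)"
proof -
  have dir: "directed_set D le" and zS: "\<And>i. i \<in> D \<Longrightarrow> z i \<in> S"
    using net by (auto simp: net_in_def)
  define F where "F = filtermap z (tails D le)"
  have evF: "eventually P F \<longleftrightarrow> (\<exists>i\<in>D. \<forall>j\<in>D. le i j \<longrightarrow> P (z j))" for P
    unfolding F_def eventually_filtermap using eventually_tails[OF dir] by simp
  have S: "eventually (\<lambda>b. b \<in> S) F"
    using dir zS unfolding evF directed_set_def by blast
  have ne: "\<exists>b. P b" if "eventually P F" for P
    using that dir unfolding evF directed_set_def by blast
  define D' where "D' = {(p, A). p \<in> A \<and> A \<subseteq> S \<and> eventually (\<lambda>b. b \<in> A) F}"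
  define le' :: "'b net_index \<Rightarrow> 'b net_index \<Rightarrow> bool"
    where "le' = (\<lambda>u v. snd v \<subseteq> snd u)"
  have dir': "directed_set D' le'"
    unfolding directed_set_def
  proof (intro conjI ballI impI)
    obtain p where "p \<in> S" using ne[OF S] by blast
    then have "(p, S) \<in> D'" using S by (simp add: D'_def)
    then show "D' \<noteq> {}" by blast
  next
    fix u v assume "u \<in> D'" "v \<in> D'"
    then have e: "eventually (\<lambda>b. b \<in> snd u \<inter> snd v) F" and s: "snd u \<inter> snd v \<subseteq> S"
      by (auto simp: D'_def eventually_conj_iff)
    obtain p where "p \<in> snd u \<inter> snd v" using ne[OF e] by blast
    then have "(p, snd u \<inter> snd v) \<in> D'" using e s by (simp add: D'_def)
    then show "\<exists>k\<in>D'. le' u k \<and> le' v k"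
      by (rule rev_bexI) (simp add: le'_def)
  qed (auto simp: le'_def)
  have "net_in D' le' fst S"
    using dir' by (auto simp: net_in_def D'_def)
  moreover have "filtermap fst (tails D' le') = F"
  proof (rule filter_eqI)
    fix P
    have "eventually P (filtermap fst (tails D' le')) \<longleftrightarrow>
        (\<exists>u\<in>D'. \<forall>v\<in>D'. le' u v \<longrightarrow> P (fst v))"
      by (simp add: eventually_filtermap eventually_tails[OF dir'])
    also have "\<dots> \<longleftrightarrow> eventually P F"
    proof
      assume "\<exists>u\<in>D'. \<forall>v\<in>D'. le' u v \<longrightarrow> P (fst v)"
      then obtain u where u: "u \<in> D'" "\<And>v. v \<in> D' \<Longrightarrow> le' u v \<Longrightarrow> P (fst v)" by blast
      have "P b" if "b \<in> snd u" for b
        using u(1) u(2)[of "(b, snd u)"] that by (auto simp: D'_def le'_def)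
      moreover have "eventually (\<lambda>b. b \<in> snd u) F" using u(1) by (auto simp: D'_def)
      ultimately show "eventually P F" by (auto elim: eventually_mono)
    next
      assume P: "eventually P F"
      have e: "eventually (\<lambda>b. b \<in> {b \<in> S. P b}) F"
        using eventually_conj[OF S P] by simp
      obtain p where "p \<in> {b \<in> S. P b}" using ne[OF e] by blast
      then have "(p, {b \<in> S. P b}) \<in> D'" using e by (auto simp: D'_def)
      then show "\<exists>u\<in>D'. \<forall>v\<in>D'. le' u v \<longrightarrow> P (fst v)"
        by (rule rev_bexI) (auto simp: D'_def le'_def)
    qed
    finally show "eventually P (filtermap fst (tails D' le')) = eventually P F" .
  qed
  ultimately show ?thesis unfolding F_def by blast
qed


section \<open>The essential numerical range\<close>

definition Pi_set :: "('a::complex_normed_vector \<times> ('a \<Rightarrow>\<^sub>L complex)) set"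
  where "Pi_set = {(x, f). f \<in> dual_space \<and> norm x = 1 \<and> norm f = 1 \<and> blinfun_apply f x = 1}"

definition essential_numerical_range ::
    "('a::complex_normed_vector \<Rightarrow>\<^sub>L 'a) \<Rightarrow> complex set" ("W\<^sub>e")
  where "W\<^sub>e T = {l. \<exists>(D :: ('a \<times> ('a \<Rightarrow>\<^sub>L complex)) net_index set) le x f.
    net_in D le (\<lambda>i. (x i, f i)) Pi_set \<and>
    weakly_tendsto x 0 (tails D le) \<and>
    ((\<lambda>i. blinfun_apply (f i) (blinfun_apply T (x i))) \<longlongrightarrow> l) (tails D le)}"

end

theory Submission
  imports Defs
begin

text \<open>
  Two implications carry the content; the passage from exact pairs to almost norming pairs is
  immediate because the pairs of a net in \<^const>\<open>Pi_set\<close> satisfy the limit conditions exactly.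

  From exact pairs in every finite-codimensional subspace to the essential numerical range: the
  common kernel of finitely many functionals is closed and of finite codimension. Choosing an exact
  pair in the kernel of a finite set of functionals, with an error below \<open>1 / (n + 1)\<close>, gives a
  net along which every fixed functional eventually vanishes.

  From a net of almost norming pairs to an exact pair \<open>(z, h)\<close> with \<open>z\<close> in a given
  finite-codimensional \<open>M\<close>: the obvious tool is the Bishop--Phelps--Bollobas theorem, which moves an
  almost norming pair to a nearby exact one. Applied in the whole space it moves the vector out of
  \<open>M\<close>; applied in \<open>M\<close> it gives a functional on \<open>M\<close> only. The remedy is to carry it out in \<open>M\<close> and
  to extend the functional \<open>h\<close> to the whole space with norm 1. Such an extension is close to the
  given functional \<open>f\<close> on \<open>M\<close>; off \<open>M\<close> only its norm is under control. That is enough: \<open>T x\<close> tends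
  weakly to 0 along the net together with \<open>x\<close>, and a weakly null net approaches every closed
  subspace of finite codimension in norm. So \<open>h\<close> and \<open>f\<close> are evaluated at a point \<open>T x\<close> that almost
  lies in \<open>M\<close>, where they nearly agree.

  The subspace version of the Bishop--Phelps--Bollobas theorem
  (\<open>bishop_phelps_bollobas_subspace\<close>) combines Ekeland's variational principle on the unit
  ball of \<open>M\<close>, which produces \<open>z\<close>, with a Hahn--Banach theorem of Mazur--Orlicz type, which produces
  the real part of a multiple of \<open>h\<close> on the whole space in one step from the bounds required on \<open>z\<close>, on \<open>M\<close> and
  on the norm. The passage from weak convergence to distances (\<open>infdist_weakly_null\<close>) is an
  induction on the codimension, in which the same Hahn--Banach theorem separates a vector from
  a closed subspace.
\<close>

section \<open>Sublinear functionals and the Hahn--Banach theorem\<close>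

text \<open>
  One inequality for positive scalars suffices in the definition: applied to \<open>1 / c\<close> it gives the
  converse one, and the value at 0 follows from homogeneity.
\<close>

definition sublinear :: "('a::real_vector \<Rightarrow> real) \<Rightarrow> bool"
  where "sublinear p \<longleftrightarrow>
    (\<forall>x y. p (x + y) \<le> p x + p y) \<and> (\<forall>c x. 0 < c \<longrightarrow> p (c *\<^sub>R x) \<le> c * p x)"

lemma sublinear_add: "sublinear p \<Longrightarrow> p (x + y) \<le> p x + p y"
  by (simp add: sublinear_def)

lemma sublinear_scaleR:
  assumes "sublinear p" "0 < c"
  shows "p (c *\<^sub>R x) = c * p x"
proof (rule antisym)
  show "p (c *\<^sub>R x) \<le> c * p x" using assms by (simp add: sublinear_def)
  have "p ((1 / c) *\<^sub>R c *\<^sub>R x) \<le> (1 / c) * p (c *\<^sub>R x)"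
    using assms unfolding sublinear_def by (meson divide_pos_pos zero_less_one)
  then show "c * p x \<le> p (c *\<^sub>R x)" using assms(2) by (simp add: field_simps)
qed

lemma sublinear_zero: "sublinear p \<Longrightarrow> p 0 = 0"
  using sublinear_scaleR[of p 2 0] by simp

lemma sublinear_minus: "sublinear p \<Longrightarrow> - p (- x) \<le> p x"
  using sublinear_add[of p x "- x"] sublinear_zero[of p] by simp

lemma sublinear_norm: "0 \<le> s \<Longrightarrow> sublinear (\<lambda>x::'a::real_normed_vector. s * norm x)"
  unfolding sublinear_def
  by (auto simp flip: distrib_left intro!: mult_left_mono norm_triangle_ineq)

text \<open>
  The infimum of \<open>p (x + y) - a\<close> over the cone is the largest sublinear functional below \<open>p\<close> that
  takes values at most \<open>- a\<close> at \<open>- y\<close> for all \<open>(y, a)\<close> in the cone. A linear functional below it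
  therefore has values at least \<open>a\<close> at \<open>y\<close>. The hypothesis that the cone lies under the graph of
  \<open>p\<close> makes the infimum finite.
\<close>

lemma sublinear_shrink:
  fixes G :: "('a::real_vector \<times> real) set"
  assumes p: "sublinear p" and G: "convex_cone G"
    and Gp: "\<And>y a. (y, a) \<in> G \<Longrightarrow> a \<le> p y"
  shows "\<exists>q. sublinear q \<and> (\<forall>x. q x \<le> p x) \<and> (\<forall>x y a. (y, a) \<in> G \<longrightarrow> q x \<le> p (x + y) - a)"
proof -
  define q where "q x = (INF g\<in>G. p (x + fst g) - snd g)" for x
  have G0: "(0, 0) \<in> G" using convex_cone_contains_0[OF G] by (simp add: zero_prod_def)
  have bdd: "bdd_below ((\<lambda>g. p (x + fst g) - snd g) ` G)" for x
  proof (rule bdd_belowI2)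
    fix g assume "g \<in> G"
    then have "snd g \<le> p (fst g)" using Gp[of "fst g" "snd g"] by simp
    moreover have "p (fst g) \<le> p (x + fst g) + p (- x)"
      using sublinear_add[OF p, of "x + fst g" "- x"] by simp
    ultimately show "- p (- x) \<le> p (x + fst g) - snd g" by simp
  qed
  have qG: "q x \<le> p (x + y) - a" if "(y, a) \<in> G" for x y a
    unfolding q_def using cINF_lower[OF bdd that] by simp
  have greatest: "c \<le> q x" if "\<And>y a. (y, a) \<in> G \<Longrightarrow> c \<le> p (x + y) - a" for c x
    unfolding q_def using G0 that by (intro cINF_greatest) auto
  have "q x \<le> p x" for x
    using qG[OF G0, of x] by simp
  moreover have "sublinear q"
    unfolding sublinear_def
  proof (intro conjI allI impI)
    fix x y
    have "q (x + y) - (p (y + y2) - a2) \<le> q x" if g2: "(y2, a2) \<in> G" for y2 a2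
    proof (rule greatest)
      fix y1 a1 assume g1: "(y1, a1) \<in> G"
      have "(y1 + y2, a1 + a2) \<in> G" using convex_cone_add[OF G g1 g2] by simp
      then have "q (x + y) \<le> p ((x + y) + (y1 + y2)) - (a1 + a2)" by (rule qG)
      also have "(x + y) + (y1 + y2) = (x + y1) + (y + y2)" by (simp add: algebra_simps)
      also have "p \<dots> \<le> p (x + y1) + p (y + y2)" by (rule sublinear_add[OF p])
      finally show "q (x + y) - (p (y + y2) - a2) \<le> p (x + y1) - a1" by simp
    qed
    then have "q (x + y) - q x \<le> q y" by (intro greatest) (simp add: algebra_simps)
    then show "q (x + y) \<le> q x + q y" by simp
  next
    fix c :: real and x assume c: "0 < c"
    have "q (c *\<^sub>R x) / c \<le> q x"
    proof (rule greatest)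
      fix y a assume "(y, a) \<in> G"
      then have "(c *\<^sub>R y, c * a) \<in> G" using convex_cone_scaleR[OF G, of c "(y, a)"] c by simp
      then have "q (c *\<^sub>R x) \<le> p (c *\<^sub>R x + c *\<^sub>R y) - c * a" by (rule qG)
      also have "\<dots> = c * (p (x + y) - a)"
        using sublinear_scaleR[OF p c, of "x + y"] by (simp add: algebra_simps)
      finally show "q (c *\<^sub>R x) / c \<le> p (x + y) - a" using c by (simp add: field_simps)
    qed
    then show "q (c *\<^sub>R x) \<le> c * q x" using c by (simp add: field_simps)
  qed
  ultimately show ?thesis using qG by blast
qed

text \<open>
  Shrinking \<open>m\<close> along the ray through \<open>(y, m y)\<close> cannot change it, by minimality; this says that
  \<open>m (x + y) \<ge> m x + m y\<close>.
\<close>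

lemma minimal_sublinear_imp_linear:
  assumes m: "sublinear m" and min: "\<And>q. sublinear q \<Longrightarrow> (\<And>x. q x \<le> m x) \<Longrightarrow> q = m"
  shows "linear m"
proof -
  have add: "m (x + y) = m x + m y" for x y
  proof (rule antisym[OF sublinear_add[OF m]])
    define G where "G = (\<lambda>t. (t *\<^sub>R y, t * m y)) ` {0..}"
    have G: "convex_cone G"
      unfolding convex_cone_iff
    proof (intro conjI ballI allI impI)
      show "0 \<in> G" unfolding G_def by (rule image_eqI[of _ _ 0]) (auto simp: zero_prod_def)
    next
      fix u v assume "u \<in> G" "v \<in> G"
      then obtain s t where "s \<ge> 0" "t \<ge> 0" "u = (s *\<^sub>R y, s * m y)" "v = (t *\<^sub>R y, t * m y)"
        by (auto simp: G_def)
      then show "u + v \<in> G" unfolding G_def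
        by (intro image_eqI[of _ _ "s + t"]) (auto simp: algebra_simps)
    next
      fix u and c :: real assume "u \<in> G" "c \<ge> 0"
      then obtain s where "s \<ge> 0" "u = (s *\<^sub>R y, s * m y)"
        by (auto simp: G_def)
      then show "c *\<^sub>R u \<in> G" unfolding G_def using \<open>c \<ge> 0\<close>
        by (intro image_eqI[of _ _ "c * s"]) auto
    qed
    have Gm: "a \<le> m x" if "(x, a) \<in> G" for x a
    proof -
      obtain t where t: "t \<ge> 0" "x = t *\<^sub>R y" "a = t * m y" using \<open>(x, a) \<in> G\<close> by (auto simp: G_def)
      then show ?thesis
        using sublinear_scaleR[OF m, of t y] sublinear_zero[OF m] by (cases "t = 0") auto
    qed
    obtain q where q: "sublinear q" "\<forall>x. q x \<le> m x"
      "\<forall>x y a. (y, a) \<in> G \<longrightarrow> q x \<le> m (x + y) - a"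
      using sublinear_shrink[OF m G Gm] by blast
    have "(y, m y) \<in> G" unfolding G_def by (intro image_eqI[of _ _ 1]) auto
    with q(3) have "q x \<le> m (x + y) - m y" by blast
    then show "m x + m y \<le> m (x + y)"
      using min[OF q(1)] q(2) by simp
  qed
  have neg: "m (- x) = - m x" for x
    using add[of x "- x"] sublinear_zero[OF m] by simp
  have "m (c *\<^sub>R x) = c * m x" for c x
  proof -
    consider "c > 0" | "c = 0" | "- c > 0" by linarith
    then show ?thesis
    proof cases
      case 3
      then show ?thesis using sublinear_scaleR[OF m 3, of x] neg[of "c *\<^sub>R x"] by simp
    qed (simp_all add: sublinear_scaleR[OF m] sublinear_zero[OF m])
  qed
  with add show ?thesis by (intro linearI) auto
qed

text \<open>
  Zorn's lemma gives a minimal sublinear functional below \<open>q\<close>: the pointwise infimum of a chain is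
  subadditive because of any two members of the chain one is below both. The infimum is finite since
  \<open>- q (- x)\<close> is a lower bound of all values at \<open>x\<close>.
\<close>

theorem hahn_banach:
  assumes q: "sublinear q"
  shows "\<exists>h. linear h \<and> (\<forall>x. h x \<le> q x)"
proof -
  define A where "A = {p. sublinear p \<and> p \<le> q}"
  have "\<exists>m\<in>A. \<forall>p\<in>A. m \<ge> p \<longrightarrow> p = m"
  proof (rule predicate_Zorn[where P = "(\<ge>)"])
    show "partial_order_on A (relation_of (\<ge>) A)"
      by (rule partial_order_on_relation_ofI) auto
    fix C assume C: "C \<in> Chains (relation_of (\<ge>) A)"
    show "\<exists>u\<in>A. \<forall>p\<in>C. p \<ge> u"
    proof (cases "C = {}")
      case True
      then show ?thesis using q by (auto simp: A_def)
    next
      case False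
      have CA: "p \<in> A" if "p \<in> C" for p
        using C that by (auto simp: Chains_def relation_of_def)
      have chain: "p \<le> p' \<or> p' \<le> p" if "p \<in> C" "p' \<in> C" for p p'
        using C that by (auto simp: Chains_def relation_of_def)
      define u where "u x = (INF p\<in>C. p x)" for x
      have bdd: "bdd_below ((\<lambda>p. p x) ` C)" for x
      proof (rule bdd_belowI2)
        fix p assume "p \<in> C"
        then have "sublinear p" "p (- x) \<le> q (- x)" using CA by (auto simp: A_def le_fun_def)
        then show "- q (- x) \<le> p x" using sublinear_minus[of p x] by linarith
      qed
      have lower: "u x \<le> p x" if "p \<in> C" for p x
        unfolding u_def by (rule cINF_lower[OF bdd that])
      have greatest: "c \<le> u x" if "\<And>p. p \<in> C \<Longrightarrow> c \<le> p x" for c x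
        unfolding u_def using False that by (intro cINF_greatest) auto
      have "sublinear u"
        unfolding sublinear_def
      proof (intro conjI allI impI)
        fix x y
        have "u (x + y) \<le> p x + p' y" if p: "p \<in> C" "p' \<in> C" for p p'
        proof -
          obtain r where r: "r \<in> C" "r \<le> p" "r \<le> p'" using chain[OF p] p by auto
          have "u (x + y) \<le> r (x + y)" by (rule lower[OF r(1)])
          also have "\<dots> \<le> r x + r y" using CA[OF r(1)] by (simp add: A_def sublinear_add)
          also have "\<dots> \<le> p x + p' y" using r by (intro add_mono) (auto simp: le_fun_def)
          finally show ?thesis .
        qed
        then have "u (x + y) - p' y \<le> u x" if "p' \<in> C" for p'
          using that by (intro greatest) (simp add: algebra_simps)
        then have "u (x + y) - u x \<le> u y"
          by (intro greatest) (simp add: algebra_simps)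
        then show "u (x + y) \<le> u x + u y" by simp
      next
        fix c :: real and x assume c: "0 < c"
        have "u (c *\<^sub>R x) / c \<le> u x"
        proof (rule greatest)
          fix p assume p: "p \<in> C"
          have "u (c *\<^sub>R x) \<le> p (c *\<^sub>R x)" by (rule lower[OF p])
          also have "\<dots> = c * p x" using CA[OF p] c by (simp add: A_def sublinear_scaleR)
          finally show "u (c *\<^sub>R x) / c \<le> p x" using c by (simp add: field_simps)
        qed
        then show "u (c *\<^sub>R x) \<le> c * u x" using c by (simp add: field_simps)
      qed
      moreover have "u \<le> q"
      proof -
        obtain p where "p \<in> C" using False by blast
        then have "u \<le> p" "p \<le> q" using lower CA by (auto simp: A_def le_fun_def)
        then show ?thesis by simp
      qed
      ultimately show ?thesis using lower by (intro bexI[of _ u]) (auto simp: A_def le_fun_def)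
    qed
  qed
  then obtain m where m: "sublinear m" "m \<le> q" "\<And>p. p \<in> A \<Longrightarrow> p \<le> m \<Longrightarrow> p = m"
    by (auto simp: A_def)
  have "linear m"
  proof (rule minimal_sublinear_imp_linear[OF m(1)])
    fix p assume "sublinear p" "\<And>x. p x \<le> m x"
    then have "p \<le> m" by (simp add: le_fun_def)
    with \<open>sublinear p\<close> m(2) have "p \<in> A" by (auto simp: A_def)
    then show "p = m" using m(3) \<open>p \<le> m\<close> by blast
  qed
  with m(2) show ?thesis by (auto simp: le_fun_def)
qed

text \<open>
  This form of the Hahn--Banach theorem prescribes an upper bound \<open>p\<close> on the whole space and any
  family of lower bounds \<open>h y \<ge> a\<close> that is closed under conic combinations and compatible with \<open>p\<close>.
  Values on a subspace, norm bounds, and closeness to another functional are all of this kind.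
\<close>

theorem mazur_orlicz:
  assumes p: "sublinear p" and G: "convex_cone G"
    and Gp: "\<And>y a. (y, a) \<in> G \<Longrightarrow> a \<le> p y"
  obtains h where "linear h" "\<And>x. h x \<le> p x" "\<And>y a. (y, a) \<in> G \<Longrightarrow> a \<le> h y"
proof -
  obtain q where q: "sublinear q" "\<forall>x. q x \<le> p x"
    "\<forall>x y a. (y, a) \<in> G \<longrightarrow> q x \<le> p (x + y) - a"
    using sublinear_shrink[OF p G Gp] by blast
  obtain h where h: "linear h" "\<forall>x. h x \<le> q x" using hahn_banach[OF q(1)] by blast
  show thesis
  proof (rule that[OF h(1)])
    show "h x \<le> p x" for x using h(2) q(2) order_trans by blast
    fix y a assume "(y, a) \<in> G"
    with q(3) have "q (- y) \<le> p (- y + y) - a" by blast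
    moreover have "h (- y) \<le> q (- y)" using h(2) by blast
    ultimately show "a \<le> h y"
      using sublinear_zero[OF p] linear_neg[OF h(1), of y] by simp
  qed
qed

section \<open>Ekeland's variational principle\<close>

text \<open>
  The sets \<open>S x = {w \<in> C. \<phi> x + k * dist x w \<le> \<phi> w}\<close> shrink as one passes from \<open>x\<close> to a
  point of \<open>S x\<close>. Moving each time to a point where \<open>\<phi>\<close> is nearly maximal on the current set makes
  their diameters tend to 0, so by completeness they meet in one point \<open>z\<close>. Then \<open>S z\<close> contains
  only \<open>z\<close>, which implies the last claim.
\<close>

theorem ekeland:
  fixes C :: "'a::complete_space set" and \<phi> :: "'a \<Rightarrow> real"
  assumes C: "closed C" and y: "y \<in> C" and cont: "continuous_on C \<phi>"
    and bdd: "bdd_above (\<phi> ` C)" and k: "0 < k"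
  obtains z where "z \<in> C" "\<phi> y + k * dist y z \<le> \<phi> z"
    "\<And>w. w \<in> C \<Longrightarrow> \<phi> w \<le> \<phi> z + k * dist z w"
proof -
  define S where "S x = {w \<in> C. \<phi> x + k * dist x w \<le> \<phi> w}" for x
  have closed: "closed (S x)" for x
    unfolding S_def by (intro continuous_on_closed_Collect_le continuous_intros cont C)
  have refl: "x \<in> S x" if "x \<in> C" for x using that by (simp add: S_def)
  have trans: "S w \<subseteq> S x" if w: "w \<in> S x" for w x
  proof
    fix v assume "v \<in> S w"
    moreover have "k * dist x v \<le> k * dist x w + k * dist w v"
      using k dist_triangle[of x v w] by (simp flip: distrib_left)
    ultimately show "v \<in> S x" using w by (simp add: S_def)
  qed
  (* The step from X n to X (Suc n) stays in S (X n) and is within k / 2^n of the supremum there. *)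
  have "\<exists>X. \<forall>n. (X n \<in> C \<and> (n = 0 \<longrightarrow> X n = y)) \<and>
      (X (Suc n) \<in> S (X n) \<and> (\<forall>w\<in>S (X n). \<phi> w \<le> \<phi> (X (Suc n)) + k * (1/2) ^ n))"
  proof (rule dependent_nat_choice)
    show "\<exists>x. x \<in> C \<and> (0 = (0::nat) \<longrightarrow> x = y)" using y by blast
    fix x n assume "x \<in> C \<and> (n = (0::nat) \<longrightarrow> x = y)"
    then have x: "x \<in> C" ..
    have bS: "bdd_above (\<phi> ` S x)" by (rule bdd_above_mono[OF bdd]) (auto simp: S_def)
    have neS: "\<phi> ` S x \<noteq> {}" using refl[OF x] by blast
    have "Sup (\<phi> ` S x) - k * (1/2) ^ n < Sup (\<phi> ` S x)" using k by simp
    then obtain x' where x': "x' \<in> S x" "Sup (\<phi> ` S x) - k * (1/2) ^ n < \<phi> x'"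
      by (subst (asm) less_cSup_iff[OF neS bS]) blast
    have "\<phi> w \<le> \<phi> x' + k * (1/2) ^ n" if "w \<in> S x" for w
      using cSUP_upper[OF that bS] x'(2) by linarith
    with x'(1) show "\<exists>x'. (x' \<in> C \<and> (Suc n = 0 \<longrightarrow> x' = y)) \<and>
        (x' \<in> S x \<and> (\<forall>w\<in>S x. \<phi> w \<le> \<phi> x' + k * (1/2) ^ n))"
      by (intro exI[of _ x']) (auto simp: S_def)
  qed
  then obtain X where X: "\<And>n. X n \<in> C" "X 0 = y" "\<And>n. X (Suc n) \<in> S (X n)"
    "\<And>n w. w \<in> S (X n) \<Longrightarrow> \<phi> w \<le> \<phi> (X (Suc n)) + k * (1/2) ^ n"
    by blast
  have near: "dist (X (Suc n)) w \<le> (1/2) ^ n" if "w \<in> S (X (Suc n))" for w n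
  proof -
    have "w \<in> S (X n)" using that trans[OF X(3)] by blast
    from X(4)[OF this] that have "k * dist (X (Suc n)) w \<le> k * (1/2) ^ n" by (simp add: S_def)
    then show ?thesis using k by simp
  qed
  have small: "\<exists>n. \<forall>v\<in>S (X n). \<forall>w\<in>S (X n). dist v w < e" if e: "e > 0" for e
  proof -
    obtain n where n: "(1/2) ^ n < e / 2"
      using real_arch_pow_inv[of "e / 2" "1/2"] e by force
    have "dist v w < e" if vw: "v \<in> S (X (Suc n))" "w \<in> S (X (Suc n))" for v w
      using near[OF vw(1)] near[OF vw(2)] dist_triangle3[of v w "X (Suc n)"] n by linarith
    then show ?thesis by blast
  qed
  have anti: "S (X n) \<subseteq> S (X m)" if "m \<le> n" for m n
    by (rule lift_Suc_antimono_le[of "\<lambda>n. S (X n)", OF _ that]) (rule trans[OF X(3)])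
  obtain z where z: "\<Inter>(range (\<lambda>n. S (X n))) = {z}"
    using decreasing_closed_nest_sing[of "\<lambda>n. S (X n)"] closed refl[OF X(1)] anti small
    by (metis (no_types) empty_iff)
  show thesis
  proof
    have zS: "z \<in> S (X n)" for n using z by blast
    show "z \<in> C" using zS[of 0] by (simp add: S_def)
    show "\<phi> y + k * dist y z \<le> \<phi> z" using zS[of 0] X(2) by (simp add: S_def)
    fix w assume w: "w \<in> C"
    show "\<phi> w \<le> \<phi> z + k * dist z w"
    proof (rule ccontr)
      assume *: "\<not> ?thesis"
      then have "w \<in> S z" using w by (simp add: S_def)
      then have "w \<in> S (X n)" for n using trans[OF zS] by blast
      then have "w = z" using z by blast
      with * show False by simp
    qed
  qed
qed

section \<open>Complex functionals and separation\<close>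

lemma cblinfun_iff:
  "f \<in> cblinfun \<longleftrightarrow> (\<forall>c x. blinfun_apply f (c *\<^sub>C x) = c *\<^sub>C blinfun_apply f x)"
  by (simp add: cblinfun_def Vector_Spaces.linear_iff blinfun.add_right
      complex_vector.vector_space_axioms)

lemma dual_space_iff:
  "f \<in> dual_space \<longleftrightarrow> (\<forall>c x. blinfun_apply f (c *\<^sub>C x) = c * blinfun_apply f x)"
  by (simp add: cblinfun_iff scaleC_complex_def)

lemma complex_subspace_scaleR:
  "complex_vector.subspace M \<Longrightarrow> x \<in> M \<Longrightarrow> r *\<^sub>R x \<in> M"
  by (simp add: scaleR_scaleC complex_vector.subspace_scale)

text \<open>
  Multiplying \<open>x\<close> by a unimodular scalar turns the value of \<open>f\<close> into its modulus, and does not leave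
  the complex subspace.
\<close>

lemma cmod_le_if_Re_le:
  fixes f :: "'a::complex_normed_vector \<Rightarrow> complex"
  assumes M: "complex_vector.subspace M"
    and hom: "\<And>c x. f (c *\<^sub>C x) = c * f x"
    and Re: "\<And>x. x \<in> M \<Longrightarrow> Re (f x) \<le> K * norm x" and x: "x \<in> M"
  shows "cmod (f x) \<le> K * norm x"
proof -
  define c where "c = cnj (sgn (f x))"
  have "c * f x = complex_of_real (cmod (f x))"
    using complex_norm_square[of "f x"]
    by (cases "f x = 0") (simp_all add: c_def sgn_eq field_simps power2_eq_square)
  then have "cmod (f x) = Re (f (c *\<^sub>C x))" by (simp add: hom)
  also have "\<dots> \<le> K * norm (c *\<^sub>C x)"
    by (rule Re[OF complex_vector.subspace_scale[OF M x]])
  finally show ?thesis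
    using Re[OF x] by (cases "f x = 0") (simp_all add: norm_scaleC c_def norm_sgn)
qed

text \<open>
  A real functional is the real part of exactly one complex functional, and a bound on the real
  part bounds the modulus with the same constant.
\<close>

lemma complexification:
  fixes h :: "'a::complex_normed_vector \<Rightarrow> real"
  assumes h: "linear h" and bound: "\<And>x. h x \<le> K * norm x" and K: "0 \<le> K"
  shows "\<exists>f\<in>dual_space. norm f \<le> K \<and> (\<forall>x. blinfun_apply f x = Complex (h x) (- h (\<i> *\<^sub>C x)))"
proof -
  define f where "f x = Complex (h x) (- h (\<i> *\<^sub>C x))" for x
  have scaleR: "h (complex_of_real r *\<^sub>C x) = r * h x" for r x
    using linear_scale[OF h, of r x] by (simp add: scaleR_scaleC)
  have add: "f (x + y) = f x + f y" for x y
    by (simp add: f_def linear_add[OF h] scaleC_add_right complex_eq_iff)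
  have hom: "f (c *\<^sub>C x) = c * f x" for c x
  proof -
    have c: "c = complex_of_real (Re c) + complex_of_real (Im c) * \<i>"
      by (simp add: complex_eq_iff)
    have "c *\<^sub>C x = complex_of_real (Re c) *\<^sub>C x + complex_of_real (Im c) *\<^sub>C \<i> *\<^sub>C x"
      by (subst c) (simp add: scaleC_add_left scaleC_scaleC)
    then have 1: "h (c *\<^sub>C x) = Re c * h x + Im c * h (\<i> *\<^sub>C x)"
      by (simp only: linear_add[OF h] scaleR)
    have "\<i> * c = complex_of_real (Re c) * \<i> + complex_of_real (- Im c)"
      by (simp add: complex_eq_iff)
    then have "\<i> *\<^sub>C c *\<^sub>C x = complex_of_real (Re c) *\<^sub>C \<i> *\<^sub>C x + complex_of_real (- Im c) *\<^sub>C x"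
      by (simp only: scaleC_scaleC scaleC_add_left)
    then have 2: "h (\<i> *\<^sub>C c *\<^sub>C x) = Re c * h (\<i> *\<^sub>C x) - Im c * h x"
      by (simp add: linear_add[OF h] scaleR del: of_real_minus complex_vector.scale_scale)
    show ?thesis unfolding f_def 1 2 by (simp add: complex_eq_iff algebra_simps)
  qed
  have norm: "cmod (f x) \<le> K * norm x" for x
    by (rule cmod_le_if_Re_le[OF complex_vector.subspace_UNIV, of f])
      (simp_all add: hom, simp add: f_def bound)
  have "bounded_linear f"
    by (rule bounded_linear_intro[of f K])
      (use add hom norm in \<open>simp_all add: scaleR_scaleC mult.commute scaleR_conv_of_real flip: scaleC_complex_def\<close>)
  then have "blinfun_apply (Blinfun f) = f" by (rule bounded_linear_Blinfun_apply)
  then show ?thesis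
    using hom norm K by (intro bexI[of _ "Blinfun f"]) (simp_all add: norm_blinfun_bound dual_space_iff f_def)
qed

text \<open>
  With \<open>d\<close> the distance from \<open>b\<close> to \<open>M\<close>, the lower bounds \<open>h (t b + m) \<ge> t d\<close> are compatible with
  the norm. On the subspace \<open>M\<close> they say \<open>h \<ge> 0\<close>, hence \<open>h = 0\<close>.
\<close>

lemma closed_subspace_separation:
  fixes M :: "'a::complex_normed_vector set"
  assumes M: "complex_vector.subspace M" "closed M" and b: "b \<notin> M"
  obtains g where "g \<in> dual_space" "\<And>m. m \<in> M \<Longrightarrow> blinfun_apply g m = 0" "blinfun_apply g b = 1"
proof -
  define d where "d = infdist b M"
  have M0: "0 \<in> M" by (rule complex_vector.subspace_0[OF M(1)])
  have d: "0 < d" unfolding d_def using infdist_pos_not_in_closed[OF M(2) _ b] M0 by blast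
  define G where "G = {(t *\<^sub>R b + m, t * d) | t m. 0 \<le> t \<and> m \<in> M}"
  have G: "convex_cone G"
    unfolding convex_cone_iff
  proof (intro conjI ballI allI impI)
    show "0 \<in> G"
      using M0 unfolding G_def zero_prod_def by (intro CollectI exI[of _ 0]) auto
  next
    fix v w assume "v \<in> G" "w \<in> G"
    then obtain s m t n where "v = (s *\<^sub>R b + m, s * d)" "w = (t *\<^sub>R b + n, t * d)"
      "0 \<le> s" "0 \<le> t" "m \<in> M" "n \<in> M" by (auto simp: G_def)
    then show "v + w \<in> G" unfolding G_def
      by (intro CollectI exI[of _ "s + t"] exI[of _ "m + n"])
        (auto simp: algebra_simps complex_vector.subspace_add[OF M(1)])
  next
    fix v and c :: real assume "v \<in> G" "c \<ge> 0"
    then obtain s m where "v = (s *\<^sub>R b + m, s * d)" "0 \<le> s" "m \<in> M" by (auto simp: G_def)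
    then show "c *\<^sub>R v \<in> G" unfolding G_def using \<open>c \<ge> 0\<close>
      by (intro CollectI exI[of _ "c * s"] exI[of _ "c *\<^sub>R m"])
        (auto simp: algebra_simps complex_subspace_scaleR[OF M(1)])
  qed
  have Gn: "a \<le> 1 * norm x" if "(x, a) \<in> G" for x a
  proof -
    obtain t m where t: "x = t *\<^sub>R b + m" "a = t * d" "0 \<le> t" "m \<in> M"
      using \<open>(x, a) \<in> G\<close> by (auto simp: G_def)
    show ?thesis
    proof (cases "t = 0")
      case False
      have "d \<le> dist b (- (1 / t) *\<^sub>R m)"
        unfolding d_def by (intro infdist_le complex_subspace_scaleR[OF M(1)] t(4))
      then have "t * d \<le> t * norm (b + (1 / t) *\<^sub>R m)"
        using t(3) by (simp add: dist_norm mult_left_mono)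
      also have "\<dots> = norm (t *\<^sub>R (b + (1 / t) *\<^sub>R m))" using t(3) by simp
      also have "t *\<^sub>R (b + (1 / t) *\<^sub>R m) = x" using False t(1) by (simp add: algebra_simps)
      finally show ?thesis using t(2) by simp
    qed (use t in simp)
  qed
  obtain h where h: "linear h" "\<And>x. h x \<le> 1 * norm x" "\<And>x a. (x, a) \<in> G \<Longrightarrow> a \<le> h x"
    using mazur_orlicz[OF sublinear_norm G Gn] by auto
  have hb: "d \<le> h b" using M0 unfolding G_def by (intro h(3)) (force simp: G_def)
  have hM: "h m = 0" if "m \<in> M" for m
  proof -
    have "0 \<le> h m'" if "m' \<in> M" for m' using that by (intro h(3)) (force simp: G_def)
    from this[of m] this[of "- m"] show ?thesis
      using that linear_neg[OF h(1), of m] complex_vector.subspace_neg[OF M(1)] by force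
  qed
  obtain f where f: "f \<in> dual_space" "\<And>x. blinfun_apply f x = Complex (h x) (- h (\<i> *\<^sub>C x))"
    using complexification[OF h(1,2)] by auto
  have fb: "blinfun_apply f b \<noteq> 0" using hb d f(2)[of b] by (auto simp: complex_eq_iff)
  have fM: "blinfun_apply f m = 0" if "m \<in> M" for m
    using that f(2) hM complex_vector.subspace_scale[OF M(1)] by (simp add: complex_eq_iff)
  define g where "g = Blinfun (\<lambda>x. blinfun_apply f x / blinfun_apply f b)"
  have g: "blinfun_apply g x = blinfun_apply f x / blinfun_apply f b" for x
    unfolding g_def
    by (subst bounded_linear_Blinfun_apply)
      (auto intro: bounded_linear_compose[OF bounded_linear_divide blinfun.bounded_linear_right])
  show thesis
    using f(1) fb fM by (intro that[of g]) (auto simp: g dual_space_iff)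
qed

section \<open>Weakly null nets and subspaces of finite codimension\<close>

text \<open>
  The proof removes one spanning vector \<open>b\<close> of the complement at a time. A functional \<open>g\<close> that
  vanishes on \<open>M\<close> and is 1 at \<open>b\<close> describes the sum of \<open>M\<close> and the line through \<open>b\<close> as
  \<open>{v. v - g v b \<in> M}\<close>, which shows that this sum is closed; and since \<open>g (x i)\<close> tends to 0, being
  close to the sum implies being close to \<open>M\<close>.
\<close>

lemma infdist_weakly_null:
  fixes x :: "'i \<Rightarrow> 'a::complex_normed_vector"
  assumes "finite B" and M: "complex_vector.subspace M" "closed M"
    and span: "complex_vector.span (M \<union> B) = UNIV" and x: "weakly_tendsto x 0 F"
  shows "((\<lambda>i. infdist (x i) M) \<longlongrightarrow> 0) F"
  using assms(1) M span
proof (induction B arbitrary: M)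
  case empty
  then have "M = UNIV" by (simp add: complex_vector.span_eq_iff[THEN iffD2])
  then show ?case by simp
next
  case (insert b B)
  show ?case
  proof (cases "b \<in> M")
    case True
    then have "M \<union> insert b B = M \<union> B" by blast
    then show ?thesis using insert by simp
  next
    case False
    obtain g where g: "g \<in> dual_space" "\<And>m. m \<in> M \<Longrightarrow> blinfun_apply g m = 0" "blinfun_apply g b = 1"
      using closed_subspace_separation[OF insert.prems(1,2) False] by blast
    have g_hom: "blinfun_apply g (c *\<^sub>C v) = c * blinfun_apply g v" for c v
      using g(1) by (simp add: dual_space_iff)
    (* r is the projection along b; it maps M', the sum of M and the line through b, onto M. *)
    define r where "r v = v - blinfun_apply g v *\<^sub>C b" for v
    define M' where "M' = {v. r v \<in> M}"
    have r_add: "r (v + w) = r v + r w" and r_scale: "r (c *\<^sub>C v) = c *\<^sub>C r v" for v w c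
      by (simp_all add: r_def blinfun.add_right scaleC_add_left g_hom
          complex_vector.scale_right_diff_distrib scaleC_scaleC)
    have M': "complex_vector.subspace M'"
      using insert.prems(1) unfolding complex_vector.subspace_def M'_def
      by (simp add: r_add r_scale) (simp add: r_def blinfun.zero_right)
    have r_dist: "dist (r v) (r w) \<le> (1 + norm g * norm b) * dist v w" for v w
    proof -
      have "r v - r w = (v - w) - blinfun_apply g (v - w) *\<^sub>C b"
        by (simp add: r_def blinfun.diff_right complex_vector.scale_left_diff_distrib)
      then have "norm (r v - r w) \<le> norm (v - w) + cmod (blinfun_apply g (v - w)) * norm b"
        by (metis norm_triangle_ineq4 norm_scaleC)
      also have "\<dots> \<le> norm (v - w) + (norm g * norm (v - w)) * norm b"
        by (intro add_left_mono mult_right_mono norm_blinfun) simp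
      finally show ?thesis by (simp add: dist_norm algebra_simps)
    qed
    have "continuous_on UNIV r"
    proof (rule lipschitz_on_continuous_on)
      show "(1 + norm g * norm b)-lipschitz_on UNIV r"
        using r_dist by (intro lipschitz_onI) auto
    qed
    then have closed: "closed M'"
      unfolding M'_def using insert.prems(2) by (simp add: closed_vimage vimage_def[symmetric])
    have "M \<subseteq> M'" using g(2) by (auto simp: M'_def r_def)
    moreover have "b \<in> M'"
      using g(3) complex_vector.subspace_0[OF insert.prems(1)] by (simp add: M'_def r_def)
    ultimately have "complex_vector.span (M \<union> insert b B) \<subseteq> complex_vector.span (M' \<union> B)"
      by (intro complex_vector.span_mono) auto
    then have IH: "((\<lambda>i. infdist (x i) M') \<longlongrightarrow> 0) F"
      using insert.IH[OF M' closed] insert.prems(3) by blast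
    define K where "K = 1 + norm g * norm b"
    have K: "K > 0" by (simp add: K_def add_pos_nonneg)
    have bound: "infdist v M \<le> K * infdist v M' + cmod (blinfun_apply g v) * norm b" for v
    proof -
      have "(infdist v M - cmod (blinfun_apply g v) * norm b) / K \<le> dist v w" if w: "w \<in> M'" for w
      proof -
        have "infdist v M \<le> dist v (r w)" using w by (intro infdist_le) (simp add: M'_def)
        also have "\<dots> \<le> dist v (r v) + dist (r v) (r w)" by (rule dist_triangle)
        also have "dist v (r v) = cmod (blinfun_apply g v) * norm b"
          by (simp add: dist_norm r_def norm_scaleC)
        finally show ?thesis using r_dist[of v w] K by (simp add: field_simps K_def)
      qed
      then have "(infdist v M - cmod (blinfun_apply g v) * norm b) / K \<le> infdist v M'"
        using \<open>b \<in> M'\<close> by (subst infdist_notempty) (auto intro!: cINF_greatest)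
      then show ?thesis using K by (simp add: field_simps)
    qed
    have "((\<lambda>i. blinfun_apply g (x i)) \<longlongrightarrow> 0) F"
      using x g(1) unfolding weakly_tendsto_def by (auto simp: blinfun.zero_right)
    then have "((\<lambda>i. K * infdist (x i) M' + cmod (blinfun_apply g (x i)) * norm b) \<longlongrightarrow>
        K * 0 + cmod 0 * norm b) F"
      by (intro tendsto_intros IH)
    then have lim: "((\<lambda>i. K * infdist (x i) M' + cmod (blinfun_apply g (x i)) * norm b) \<longlongrightarrow> 0) F"
      by simp
    show ?thesis
    proof (rule tendsto_sandwich[OF _ _ tendsto_const lim])
      show "\<forall>\<^sub>F i in F. 0 \<le> infdist (x i) M"
        by (simp add: infdist_nonneg)
      show "\<forall>\<^sub>F i in F. infdist (x i) M \<le> K * infdist (x i) M' + cmod (blinfun_apply g (x i)) * norm b"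
        using bound by simp
    qed
  qed
qed

section \<open>Bishop--Phelps--Bollobas on a subspace\<close>

text \<open>
  Let \<open>u\<close> be the real part of \<open>f\<close>. Ekeland's principle on the unit ball of \<open>M\<close> gives \<open>z\<close> close to
  \<open>y\<close> such that \<open>u w \<le> u z + k * dist z w\<close> for all \<open>w\<close> in that ball. Put \<open>s = u z\<close>, which is almost 1.
  After rescaling vectors of \<open>M\<close> into the ball, this inequality becomes
  \<open>s + u m - 2 * k * norm m \<le> s * norm (z + m)\<close>, the compatibility condition of the Mazur--Orlicz theorem for
  the requirements \<open>h x \<le> s * norm x\<close> on the space, \<open>h z \<ge> s\<close>, and
  \<open>h m \<ge> u m - 2 * k * norm m\<close> on \<open>M\<close>.
  Hence \<open>h\<close> has norm \<open>s\<close>, which it attains at \<open>z\<close>, and differs from \<open>u\<close> on the unit ball of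
  \<open>M\<close> by at most \<open>2 * k\<close>. Dividing by \<open>s\<close> costs another \<open>1 - s \<le> k\<close>.
\<close>

theorem bishop_phelps_bollobas_subspace:
  fixes f :: "'a::complex_banach \<Rightarrow>\<^sub>L complex"
  assumes f: "f \<in> dual_space" "norm f \<le> 1"
    and M: "complex_vector.subspace M" "closed M"
    and y: "y \<in> M" "norm y \<le> 1"
    and k: "0 < k" "k \<le> 1/2" and fy: "1 - k\<^sup>2 \<le> Re (blinfun_apply f y)"
  obtains z h where "(z, h) \<in> Pi_set" "z \<in> M" "norm (z - y) \<le> k"
    "\<And>m. m \<in> M \<Longrightarrow> cmod (blinfun_apply h m - blinfun_apply f m) \<le> 3 * k * norm m"
proof -
  define u where "u x = Re (blinfun_apply f x)" for x
  have u_add: "u (v + w) = u v + u w" and u_scale: "u (c *\<^sub>R v) = c * u v" for v w c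
    by (simp_all add: u_def blinfun.add_right blinfun.scaleR_right)
  have u_le: "u v \<le> norm v" for v
  proof -
    have "u v \<le> cmod (blinfun_apply f v)" unfolding u_def by (rule complex_Re_le_cmod)
    also have "\<dots> \<le> norm f * norm v" by (rule norm_blinfun)
    also have "\<dots> \<le> 1 * norm v" by (intro mult_right_mono f) simp
    finally show ?thesis by simp
  qed
  have k2: "k\<^sup>2 \<le> k / 2" using mult_left_mono[of k "1/2" k] k by (simp add: power2_eq_square)
  define C where "C = M \<inter> cball 0 1"
  have "closed C" unfolding C_def using M(2) by (intro closed_Int) auto
  moreover have "y \<in> C" using y by (simp add: C_def)
  moreover have "continuous_on C u"
    unfolding u_def by (intro continuous_intros)
  moreover have "bdd_above (u ` C)"
    using u_le by (intro bdd_aboveI2[of _ _ 1]) (force simp: C_def intro: order_trans)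
  ultimately obtain z where z: "z \<in> C" "u y + k * dist y z \<le> u z"
    "\<And>w. w \<in> C \<Longrightarrow> u w \<le> u z + k * dist z w"
    using ekeland[of C y u k] k(1) by blast
  define s where "s = u z"
  have zM: "z \<in> M" and "norm z \<le> 1" using z(1) by (auto simp: C_def)
  have s1: "s \<le> 1" using u_le[of z] \<open>norm z \<le> 1\<close> by (simp add: s_def)
  have uy: "1 - k\<^sup>2 \<le> u y" using fy by (simp add: u_def)
  have s0: "1 - k\<^sup>2 \<le> s" using uy z(2) k(1) zero_le_dist[of y z]
    by (smt (verit) mult_nonneg_nonneg s_def)
  have s_pos: "0 < s" using s0 k2 k by linarith
  have zy: "norm (z - y) \<le> k"
  proof -
    have "k * dist y z \<le> k * k" using z(2) s1 uy by (simp add: s_def power2_eq_square)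
    then show ?thesis using k(1) by (simp add: dist_norm norm_minus_commute)
  qed
  have norm_z: "norm z = 1"
  proof (rule ccontr)
    assume "norm z \<noteq> 1"
    (* In the interior of the ball, z could be moved in the direction y, where u grows too fast. *)
    define t where "t = 1 - norm z"
    have t: "0 < t" using \<open>norm z \<noteq> 1\<close> \<open>norm z \<le> 1\<close> by (simp add: t_def)
    have "norm (z + t *\<^sub>R y) \<le> norm z + t * norm y" using norm_triangle_ineq[of z "t *\<^sub>R y"] t by simp
    also have "\<dots> \<le> norm z + t * 1" using t y(2) by (intro add_left_mono mult_left_mono) auto
    finally have "z + t *\<^sub>R y \<in> C"
      using zM y(1) by (simp add: C_def t_def complex_vector.subspace_add[OF M(1)] complex_subspace_scaleR[OF M(1)])
    from z(3)[OF this] have "t * u y \<le> k * (t * norm y)"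
      using t by (simp add: u_add u_scale dist_norm)
    also have "\<dots> \<le> k * (t * 1)" using t k(1) y(2) by (intro mult_left_mono) auto
    finally have "u y \<le> k" using t by simp
    with uy k2 k show False by linarith
  qed
  (* The second k comes from normalising z + m: its norm differs from 1 by at most the norm of m. *)
  have key: "s + u m - 2 * k * norm m \<le> s * norm (z + m)" if m: "m \<in> M" for m
  proof (cases "z + m = 0")
    case True
    then have "m = - z" by (simp add: eq_neg_iff_add_eq_0 add.commute)
    then show ?thesis using k(1) u_scale[of "-1" z] by (simp add: s_def norm_z)
  next
    case False
    define v where "v = z + m"
    have v: "0 < norm v" using False by (simp add: v_def)
    have "(1 / norm v) *\<^sub>R v \<in> C"
      using v zM m unfolding C_def v_def
      by (simp add: complex_vector.subspace_add[OF M(1)] complex_subspace_scaleR[OF M(1)])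
    from z(3)[OF this] have "(1 / norm v) * u v \<le> s + k * norm (z - (1 / norm v) *\<^sub>R v)"
      by (simp only: u_scale dist_norm s_def)
    then have "u v \<le> s * norm v + k * (norm v * norm (z - (1 / norm v) *\<^sub>R v))"
      using v by (simp add: field_simps)
    also have "norm v * norm (z - (1 / norm v) *\<^sub>R v) = norm (norm v *\<^sub>R (z - (1 / norm v) *\<^sub>R v))"
      by simp
    also have "norm v *\<^sub>R (z - (1 / norm v) *\<^sub>R v) = (norm v - 1) *\<^sub>R z - m"
      using v by (simp add: scaleR_diff_right) (simp add: v_def algebra_simps)
    also have "k * norm \<dots> \<le> k * (2 * norm m)"
    proof (rule mult_left_mono)
      have "\<bar>norm v - 1\<bar> \<le> norm m" using norm_triangle_ineq3[of v z] norm_z by (simp add: v_def)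
      then show "norm ((norm v - 1) *\<^sub>R z - m) \<le> 2 * norm m"
        using norm_triangle_ineq4[of "(norm v - 1) *\<^sub>R z" m] norm_z by simp
    qed (use k in simp)
    finally show ?thesis by (simp add: v_def u_add s_def algebra_simps)
  qed
  define G where "G = {(t *\<^sub>R z + m, a) | t m a. 0 \<le> t \<and> m \<in> M \<and> a \<le> t * s + u m - 2 * k * norm m}"
  have G: "convex_cone G"
    unfolding convex_cone_iff
  proof (intro conjI ballI allI impI)
    show "0 \<in> G"
      unfolding G_def zero_prod_def
      by (intro CollectI exI[of _ "0::real"] exI[of _ "0::'a"] exI[of _ "0::real"])
        (simp add: u_def blinfun.zero_right complex_vector.subspace_0[OF M(1)])
  next
    fix v w assume "v \<in> G" "w \<in> G"
    then obtain t m a t' m' a' where vw: "v = (t *\<^sub>R z + m, a)" "w = (t' *\<^sub>R z + m', a')"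
      "0 \<le> t" "0 \<le> t'" "m \<in> M" "m' \<in> M" "a \<le> t * s + u m - 2 * k * norm m"
      "a' \<le> t' * s + u m' - 2 * k * norm m'" unfolding G_def by blast
    have "2 * k * norm (m + m') \<le> 2 * k * (norm m + norm m')"
      using k by (intro mult_left_mono norm_triangle_ineq) simp
    then have "a + a' \<le> (t + t') * s + u (m + m') - 2 * k * norm (m + m')"
      using vw(7,8) by (simp add: u_add algebra_simps)
    then show "v + w \<in> G" unfolding G_def using vw
      by (intro CollectI exI[of _ "t + t'"] exI[of _ "m + m'"] exI[of _ "a + a'"])
        (auto simp: scaleR_add_left complex_vector.subspace_add[OF M(1)])
  next
    fix v and c :: real assume "v \<in> G" and c: "c \<ge> 0"
    then obtain t m a where v: "v = (t *\<^sub>R z + m, a)"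
      "0 \<le> t" "m \<in> M" "a \<le> t * s + u m - 2 * k * norm m" unfolding G_def by blast
    have "c * a \<le> (c * t) * s + u (c *\<^sub>R m) - 2 * k * norm (c *\<^sub>R m)"
      using mult_left_mono[OF v(4) c] c by (simp add: u_scale algebra_simps)
    then show "c *\<^sub>R v \<in> G" unfolding G_def using v c
      by (intro CollectI exI[of _ "c * t"] exI[of _ "c *\<^sub>R m"] exI[of _ "c * a"])
        (auto simp: scaleR_add_right complex_subspace_scaleR[OF M(1)])
  qed
  have Gs: "a \<le> s * norm x" if "(x, a) \<in> G" for x a
  proof -
    obtain t m where t: "x = t *\<^sub>R z + m" "0 \<le> t" "m \<in> M" "a \<le> t * s + u m - 2 * k * norm m"
      using \<open>(x, a) \<in> G\<close> unfolding G_def by blast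
    show ?thesis
    proof (cases "t = 0")
      case True
      have "1 * norm m \<le> (s + 2 * k) * norm m" using s0 k2 k by (intro mult_right_mono) auto
      then show ?thesis using t True u_le[of m] by (simp add: algebra_simps)
    next
      case False
      then have t0: "0 < t" using t(2) by simp
      have "s + u ((1 / t) *\<^sub>R m) - 2 * k * norm ((1 / t) *\<^sub>R m) \<le> s * norm (z + (1 / t) *\<^sub>R m)"
        by (intro key complex_subspace_scaleR[OF M(1)] t(3))
      from mult_left_mono[OF this t(2)]
      have "t * s + u m - 2 * k * norm m \<le> s * (t * norm (z + (1 / t) *\<^sub>R m))"
        using t0 by (simp add: u_scale algebra_simps)
      also have "t * norm (z + (1 / t) *\<^sub>R m) = norm (t *\<^sub>R (z + (1 / t) *\<^sub>R m))" using t0 by simp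
      also have "t *\<^sub>R (z + (1 / t) *\<^sub>R m) = x" using t0 t(1) by (simp add: algebra_simps)
      finally show ?thesis using t(4) by simp
    qed
  qed
  have "sublinear (\<lambda>x::'a. s * norm x)" using s_pos by (intro sublinear_norm) simp
  from mazur_orlicz[OF this G Gs] obtain h where h: "linear h" "\<And>x. h x \<le> s * norm x"
    "\<And>x a. (x, a) \<in> G \<Longrightarrow> a \<le> h x"
    by auto
  have hz: "s \<le> h z"
  proof (rule h(3))
    have "1 *\<^sub>R z + 0 = z" "s \<le> 1 * s + u 0 - 2 * k * norm (0::'a)"
      by (simp_all add: u_def blinfun.zero_right)
    then show "(z, s) \<in> G" unfolding G_def using complex_vector.subspace_0[OF M(1)]
      by (metis (mono_tags, lifting) CollectI zero_le_one)
  qed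
  have hM: "u m - 2 * k * norm m \<le> h m" if "m \<in> M" for m
  proof (rule h(3))
    have "0 *\<^sub>R z + m = m" "u m - 2 * k * norm m \<le> 0 * s + u m - 2 * k * norm m" by simp_all
    then show "(m, u m - 2 * k * norm m) \<in> G" unfolding G_def using that
      by (metis (mono_tags, lifting) CollectI order_refl)
  qed
  obtain H where H: "H \<in> dual_space" "norm H \<le> s"
    "\<And>x. blinfun_apply H x = Complex (h x) (- h (\<i> *\<^sub>C x))"
    using complexification[OF h(1,2)] s_pos by auto
  have Hz: "blinfun_apply H z = complex_of_real s"
  proof -
    have "cmod (blinfun_apply H z) \<le> s"
      using norm_blinfun[of H z] H(2) by (simp add: norm_z)
    moreover have "s \<le> Re (blinfun_apply H z)" using hz H(3) by simp
    ultimately have "Re (blinfun_apply H z) = cmod (blinfun_apply H z)" "Re (blinfun_apply H z) = s"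
      using complex_Re_le_cmod[of "blinfun_apply H z"] by linarith+
    then show ?thesis using cmod_power2[of "blinfun_apply H z"] by (simp add: complex_eq_iff)
  qed
  have Hf: "cmod (blinfun_apply (f - H) m) \<le> 2 * k * norm m" if "m \<in> M" for m
  proof (rule cmod_le_if_Re_le[OF M(1) _ _ that])
    show "blinfun_apply (f - H) (c *\<^sub>C x) = c * blinfun_apply (f - H) x" for c x
      using f(1) H(1) by (simp add: dual_space_iff blinfun.diff_left algebra_simps)
    show "Re (blinfun_apply (f - H) x) \<le> 2 * k * norm x" if "x \<in> M" for x
      using hM[OF that] H(3)[of x] by (simp add: blinfun.diff_left u_def)
  qed
  define g where "g = (1 / s) *\<^sub>R H"
  have gH: "blinfun_apply H x = s *\<^sub>R blinfun_apply g x" for x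
    using s_pos by (simp add: g_def blinfun.scaleR_left)
  have "g \<in> dual_space"
    using H(1) by (simp add: g_def dual_space_iff blinfun.scaleR_left)
  moreover have gz: "blinfun_apply g z = 1"
    using Hz s_pos by (simp add: g_def blinfun.scaleR_left scaleR_conv_of_real)
  moreover have "norm g = 1"
  proof (rule antisym)
    show "norm g \<le> 1" using H(2) s_pos by (simp add: g_def field_simps)
    show "1 \<le> norm g" using norm_blinfun[of g z] gz norm_z by simp
  qed
  moreover have "cmod (blinfun_apply g m - blinfun_apply f m) \<le> 3 * k * norm m" if "m \<in> M" for m
  proof -
    have "blinfun_apply g m - blinfun_apply f m = (1 - s) *\<^sub>R blinfun_apply g m - blinfun_apply (f - H) m"
      by (simp add: blinfun.diff_left gH algebra_simps)
    then have "cmod (blinfun_apply g m - blinfun_apply f m) \<le>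
        cmod ((1 - s) *\<^sub>R blinfun_apply g m) + cmod (blinfun_apply (f - H) m)"
      by (metis norm_triangle_ineq4)
    also have "cmod ((1 - s) *\<^sub>R blinfun_apply g m) \<le> k * norm m"
    proof -
      have "cmod (blinfun_apply g m) \<le> norm m"
        using norm_blinfun[of g m] \<open>norm g = 1\<close> by simp
      moreover have "0 \<le> 1 - s" "1 - s \<le> k" using s0 s1 k2 k by auto
      ultimately show ?thesis by (auto intro!: mult_mono)
    qed
    finally show ?thesis using Hf[OF that] by simp
  qed
  ultimately show thesis using zM zy norm_z by (intro that[of z g]) (auto simp: Pi_set_def)
qed

lemma near_member_if_infdist_less:
  "infdist x M < d \<Longrightarrow> M \<noteq> {} \<Longrightarrow> \<exists>m\<in>M. dist x m < d"
  by (simp add: infdist_notempty cINF_less_iff)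

section \<open>From almost norming pairs to exact pairs\<close>

text \<open>
  The pair \<open>(x, f)\<close> is first replaced by \<open>(y, f')\<close> with \<open>y\<close> of norm 1 in \<open>M\<close> and \<open>f'\<close> of norm at
  most 1, then by an exact pair \<open>(z, h)\<close> with \<open>z\<close> in \<open>M\<close>. The two functionals \<open>h\<close> and \<open>f'\<close> are close
  on \<open>M\<close> only; the term \<open>(h - f') (T z)\<close> is nevertheless small because \<open>T z\<close> is close to \<open>T x\<close>
  and \<open>T x\<close> is close to a vector \<open>v\<close> of \<open>M\<close>.
\<close>

lemma exact_pair_near_almost_norming_pair:
  fixes T :: "'a::complex_banach \<Rightarrow>\<^sub>L 'a"
  assumes M: "complex_vector.subspace M" "closed M" and \<epsilon>: "0 < \<epsilon>"
  shows "\<exists>\<delta>>0. \<forall>x. \<forall>f\<in>dual_space.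
    infdist x M < \<delta> \<and> infdist (blinfun_apply T x) M < \<delta> \<and>
    \<bar>norm x - 1\<bar> < \<delta> \<and> \<bar>norm f - 1\<bar> < \<delta> \<and> cmod (blinfun_apply f x - 1) < \<delta> \<longrightarrow>
    (\<exists>(z, h)\<in>Pi_set. z \<in> M \<and>
      cmod (blinfun_apply h (blinfun_apply T z) - blinfun_apply f (blinfun_apply T x)) < \<epsilon>)"
proof -
  define N where "N = norm T"
  (* k is the accuracy of the exact pair. All error terms below add up to 14 * N * k + 5 * k.
     The value of delta is chosen so that Re (f' y) >= 1 - 8 * delta = 1 - k^2. *)
  define k where "k = min (1/2) (\<epsilon> / (15 * (N + 1)))"
  define \<delta> where "\<delta> = k\<^sup>2 / 8"
  have N: "0 \<le> N" by (simp add: N_def)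
  have k: "0 < k" "k \<le> 1/2" unfolding k_def using \<epsilon> N by (simp_all only: min.cobounded1) simp
  have k\<epsilon>: "15 * k * (N + 1) \<le> \<epsilon>"
  proof -
    have "k \<le> \<epsilon> / (15 * (N + 1))" by (simp add: k_def)
    then show ?thesis using N by (simp add: field_simps)
  qed
  have "k * k \<le> k * (1/2)" using k by (intro mult_left_mono) auto
  then have \<delta>: "16 * \<delta> \<le> k" "\<delta> \<le> 1/32"
    using k by (simp add: \<delta>_def power2_eq_square, unfold \<delta>_def power2_eq_square, linarith)
  have \<delta>0: "0 < \<delta>" using k by (simp add: \<delta>_def)
  note \<delta> = \<delta>0 \<delta>
  show ?thesis
  proof (intro exI[of _ \<delta>] conjI \<delta>(1) allI ballI impI, elim conjE)
    fix x f
    assume f: "f \<in> dual_space" "\<bar>norm f - 1\<bar> < \<delta>"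
      and xM: "infdist x M < \<delta>" and TxM: "infdist (blinfun_apply T x) M < \<delta>"
      and x: "\<bar>norm x - 1\<bar> < \<delta>" and fx: "cmod (blinfun_apply f x - 1) < \<delta>"
    have "M \<noteq> {}" using complex_vector.subspace_0[OF M(1)] by blast
    obtain m where m: "m \<in> M" "dist x m < \<delta>"
      using near_member_if_infdist_less[OF xM \<open>M \<noteq> {}\<close>] by blast
    obtain v where v: "v \<in> M" "norm (blinfun_apply T x - v) < \<delta>"
      using near_member_if_infdist_less[OF TxM \<open>M \<noteq> {}\<close>] by (auto simp: dist_norm)
    define y where "y = (1 / norm m) *\<^sub>R m"
    have m1: "\<bar>norm m - 1\<bar> < 2 * \<delta>"
      using m(2) x norm_triangle_ineq3[of x m] by (simp add: dist_norm)
    then have m_pos: "0 < norm m" using \<delta>(3) by linarith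
    have y: "y \<in> M" "norm y = 1"
      using m_pos m(1) by (auto simp: y_def complex_subspace_scaleR[OF M(1)])
    have "m = norm m *\<^sub>R y" using m_pos by (simp add: y_def)
    then have "m - y = (norm m - 1) *\<^sub>R y" by (simp add: scaleR_diff_left)
    then have "norm (m - y) < 2 * \<delta>" using m1 y(2) by simp
    then have xy: "norm (x - y) < 3 * \<delta>"
      using m(2) norm_triangle_ineq[of "x - m" "m - y"] by (simp add: dist_norm)
    define f' where "f' = (1 / (1 + \<delta>)) *\<^sub>R f"
    have f': "f' \<in> dual_space" "norm f' \<le> 1"
      using f \<delta>(1) by (auto simp: f'_def dual_space_iff blinfun.scaleR_left)
    have ff': "f - f' = \<delta> *\<^sub>R f'"
    proof -
      have "f = (1 + \<delta>) *\<^sub>R f'" using \<delta>(1) by (simp add: f'_def)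
      then show ?thesis by (metis add_diff_cancel_left' scaleR_add_left scaleR_one)
    qed
    have "1 - k\<^sup>2 \<le> Re (blinfun_apply f' y)"
    proof -
      have "cmod (blinfun_apply f (x - y)) \<le> norm f * norm (x - y)" by (rule norm_blinfun)
      also have "\<dots> \<le> 2 * (3 * \<delta>)" using f(2) xy \<delta>(3) by (intro mult_mono) auto
      finally have "Re (blinfun_apply f (x - y)) \<le> 6 * \<delta>"
        using complex_Re_le_cmod order_trans by fastforce
      moreover have "1 - Re (blinfun_apply f x) \<le> \<delta>"
        using complex_Re_le_cmod[of "1 - blinfun_apply f x"] fx by (simp add: norm_minus_commute)
      ultimately have "1 - 7 * \<delta> \<le> Re (blinfun_apply f y)" by (simp add: blinfun.diff_right)
      moreover have "(1 - k\<^sup>2) * (1 + \<delta>) \<le> 1 - 7 * \<delta>"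
        by (simp add: \<delta>_def algebra_simps)
      ultimately have "(1 - k\<^sup>2) * (1 + \<delta>) \<le> Re (blinfun_apply f y)" by linarith
      then show ?thesis using \<delta>(1) by (simp add: f'_def blinfun.scaleR_left field_simps)
    qed
    then obtain z h where zh: "(z, h) \<in> Pi_set" "z \<in> M" "norm (z - y) \<le> k"
      "\<And>m. m \<in> M \<Longrightarrow> cmod (blinfun_apply h m - blinfun_apply f' m) \<le> 3 * k * norm m"
      using bishop_phelps_bollobas_subspace[OF f' M y(1) _ k] y(2) by auto
    have zx: "norm (z - x) \<le> 2 * k"
      using norm_triangle_ineq4[of "z - y" "x - y"] zh(3) xy \<delta>(1,2) by simp
    have T: "norm (blinfun_apply T w) \<le> N * norm w" for w
      unfolding N_def by (rule norm_blinfun)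
    have Tzx: "norm (blinfun_apply T (z - x)) \<le> 2 * (N * k)"
      using T[of "z - x"] mult_left_mono[OF zx N] by simp
    have Tx: "norm (blinfun_apply T x) \<le> 2 * N"
    proof -
      have "norm x \<le> 2" using x \<delta>(3) by linarith
      then have "N * norm x \<le> N * 2" using N by (rule mult_left_mono)
      then show ?thesis using T[of x] by linarith
    qed
    have hf': "cmod (blinfun_apply (h - f') w) \<le> 2 * norm w" for w
    proof -
      have "norm (h - f') \<le> 2"
        using norm_triangle_ineq4[of h f'] f'(2) zh(1) by (simp add: Pi_set_def)
      then show ?thesis
        by (intro order_trans[OF norm_blinfun] mult_right_mono norm_ge_zero)
    qed
    have f'_le: "cmod (blinfun_apply f' w) \<le> norm w" for w
      using norm_blinfun[of f' w] mult_right_mono[OF f'(2), of "norm w"] by simp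
    have tri: "cmod (a + b + c + d - e) \<le> cmod a + cmod b + cmod c + cmod d + cmod e" for a b c d e
      using norm_triangle_ineq4[of "a + b + c + d" e] norm_triangle_ineq[of "a + b + c" d]
        norm_triangle_ineq[of "a + b" c] norm_triangle_ineq[of a b] by linarith
    have "blinfun_apply h (blinfun_apply T z) - blinfun_apply f (blinfun_apply T x) =
        blinfun_apply (h - f') (blinfun_apply T (z - x)) + blinfun_apply (h - f') (blinfun_apply T x - v)
        + blinfun_apply (h - f') v + blinfun_apply f' (blinfun_apply T (z - x))
        - blinfun_apply (f - f') (blinfun_apply T x)"
      by (simp add: blinfun.diff_left blinfun.diff_right)
    also have "cmod \<dots> \<le> cmod (blinfun_apply (h - f') (blinfun_apply T (z - x)))
        + cmod (blinfun_apply (h - f') (blinfun_apply T x - v))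
        + cmod (blinfun_apply (h - f') v) + cmod (blinfun_apply f' (blinfun_apply T (z - x)))
        + cmod (blinfun_apply (f - f') (blinfun_apply T x))"
      by (rule tri)
    also have "\<dots> \<le> 4 * (N * k) + 2 * k + 3 * k * (2 * N + 1) + 2 * (N * k) + 2 * (N * k)"
    proof (intro add_mono)
      show "cmod (blinfun_apply (h - f') (blinfun_apply T (z - x))) \<le> 4 * (N * k)"
        using hf'[of "blinfun_apply T (z - x)"] Tzx by linarith
      show "cmod (blinfun_apply (h - f') (blinfun_apply T x - v)) \<le> 2 * k"
        using hf'[of "blinfun_apply T x - v"] v(2) \<delta> by linarith
      have "norm v \<le> 2 * N + 1"
        using norm_triangle_ineq2[of v "blinfun_apply T x"] v(2) Tx \<delta>(3)
        by (simp add: norm_minus_commute)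
      then have "3 * k * norm v \<le> 3 * k * (2 * N + 1)" using k by (intro mult_left_mono) auto
      then show "cmod (blinfun_apply (h - f') v) \<le> 3 * k * (2 * N + 1)"
        using zh(4)[OF v(1)] by (simp add: blinfun.diff_left)
      show "cmod (blinfun_apply f' (blinfun_apply T (z - x))) \<le> 2 * (N * k)"
        using f'_le[of "blinfun_apply T (z - x)"] Tzx by linarith
      have "\<delta> * cmod (blinfun_apply f' (blinfun_apply T x)) \<le> k * (2 * N)"
        using \<delta>(1,2) order_trans[OF f'_le Tx] by (intro mult_mono) auto
      then show "cmod (blinfun_apply (f - f') (blinfun_apply T x)) \<le> 2 * (N * k)"
        using \<delta>(1) by (simp add: ff' blinfun.scaleR_left algebra_simps)
    qed
    also have "\<dots> < 15 * k * (N + 1)" using k(1) mult_nonneg_nonneg[OF N, of k] by (simp add: algebra_simps)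
    also have "\<dots> \<le> \<epsilon>" by (rule k\<epsilon>)
    finally show "\<exists>(z, h)\<in>Pi_set. z \<in> M \<and>
        cmod (blinfun_apply h (blinfun_apply T z) - blinfun_apply f (blinfun_apply T x)) < \<epsilon>"
      using zh(1,2) by blast
  qed
qed

lemma tails_neq_bot:
  assumes "directed_set D le"
  shows "tails D le \<noteq> bot"
proof -
  have "\<forall>i\<in>D. le i i" using assms by (simp add: directed_set_def)
  then show ?thesis
    unfolding trivial_limit_def eventually_tails[OF assms] by blast
qed

lemma eventually_net_in:
  assumes "net_in D le z S"
  shows "eventually (\<lambda>i. z i \<in> S) (tails D le)"
proof -
  have dir: "directed_set D le" and z: "\<forall>i\<in>D. z i \<in> S"
    using assms by (simp_all add: net_in_def)
  have "D \<noteq> {}" using dir by (simp add: directed_set_def)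
  with z show ?thesis unfolding eventually_tails[OF dir] by blast
qed

text \<open>
  Since \<open>T\<close> is weakly continuous, both \<open>x i\<close> and \<open>T (x i)\<close> are weakly null, so both eventually come
  arbitrarily close to \<open>M\<close>; a single late index then meets all the requirements of the preceding
  lemma.
\<close>

lemma almost_norming_imp_exact_in_subspace:
  fixes T :: "'a::complex_banach \<Rightarrow>\<^sub>L 'a"
  assumes T: "T \<in> cblinfun" and F: "F \<noteq> bot"
    and f: "eventually (\<lambda>i. f i \<in> dual_space) F" and x: "weakly_tendsto x 0 F"
    and lim: "((\<lambda>i. norm (x i)) \<longlongrightarrow> 1) F" "((\<lambda>i. norm (f i)) \<longlongrightarrow> 1) F"
      "((\<lambda>i. blinfun_apply (f i) (x i)) \<longlongrightarrow> 1) F"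
      "((\<lambda>i. blinfun_apply (f i) (blinfun_apply T (x i))) \<longlongrightarrow> l) F"
    and M: "finite_codim_subspace M" and \<epsilon>: "0 < \<epsilon>"
  shows "\<exists>(z, h)\<in>Pi_set. z \<in> M \<and> cmod (blinfun_apply h (blinfun_apply T z) - l) < \<epsilon>"
proof -
  obtain B where M': "complex_vector.subspace M" "closed M"
    and B: "finite B" "complex_vector.span (M \<union> B) = UNIV"
    using M by (auto simp: finite_codim_subspace_def)
  have Tx: "weakly_tendsto (\<lambda>i. blinfun_apply T (x i)) 0 F"
    unfolding weakly_tendsto_def
  proof
    fix g :: "'a \<Rightarrow>\<^sub>L complex" assume "g \<in> dual_space"
    then have "g o\<^sub>L T \<in> dual_space" using T by (simp add: cblinfun_iff)
    from x[unfolded weakly_tendsto_def, rule_format, OF this]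
    show "((\<lambda>i. blinfun_apply g (blinfun_apply T (x i))) \<longlongrightarrow> blinfun_apply g 0) F"
      by (simp add: blinfun.zero_right)
  qed
  obtain \<delta> where \<delta>: "0 < \<delta>"
    "\<forall>x. \<forall>f\<in>dual_space.
      infdist x M < \<delta> \<and> infdist (blinfun_apply T x) M < \<delta> \<and>
      \<bar>norm x - 1\<bar> < \<delta> \<and> \<bar>norm f - 1\<bar> < \<delta> \<and> cmod (blinfun_apply f x - 1) < \<delta> \<longrightarrow>
      (\<exists>(z, h)\<in>Pi_set. z \<in> M \<and>
        cmod (blinfun_apply h (blinfun_apply T z) - blinfun_apply f (blinfun_apply T x)) < \<epsilon> / 2)"
    using exact_pair_near_almost_norming_pair[OF M' half_gt_zero[OF \<epsilon>]] by blast
  have "eventually (\<lambda>i. f i \<in> dual_space \<and> infdist (x i) M < \<delta> \<and>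
      infdist (blinfun_apply T (x i)) M < \<delta> \<and> \<bar>norm (x i) - 1\<bar> < \<delta> \<and> \<bar>norm (f i) - 1\<bar> < \<delta> \<and>
      cmod (blinfun_apply (f i) (x i) - 1) < \<delta> \<and>
      cmod (blinfun_apply (f i) (blinfun_apply T (x i)) - l) < \<epsilon> / 2) F"
    using f order_tendstoD(2)[OF infdist_weakly_null[OF B(1) M' B(2) x] \<delta>(1)]
      order_tendstoD(2)[OF infdist_weakly_null[OF B(1) M' B(2) Tx] \<delta>(1)]
      tendstoD[OF lim(1) \<delta>(1)] tendstoD[OF lim(2) \<delta>(1)] tendstoD[OF lim(3) \<delta>(1)]
      tendstoD[OF lim(4) half_gt_zero[OF \<epsilon>]]
    by eventually_elim (simp add: dist_norm)
  then obtain i where i: "f i \<in> dual_space" "infdist (x i) M < \<delta>"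
      "infdist (blinfun_apply T (x i)) M < \<delta>" "\<bar>norm (x i) - 1\<bar> < \<delta>" "\<bar>norm (f i) - 1\<bar> < \<delta>"
      "cmod (blinfun_apply (f i) (x i) - 1) < \<delta>"
      "cmod (blinfun_apply (f i) (blinfun_apply T (x i)) - l) < \<epsilon> / 2"
    using eventually_happens'[OF F] by blast
  have "\<exists>(z, h)\<in>Pi_set. z \<in> M \<and>
      cmod (blinfun_apply h (blinfun_apply T z) - blinfun_apply (f i) (blinfun_apply T (x i))) < \<epsilon> / 2"
    using i(2-6) by (intro \<delta>(2)[rule_format, OF i(1)] conjI)
  then obtain z h where zh: "(z, h) \<in> Pi_set" "z \<in> M"
    "cmod (blinfun_apply h (blinfun_apply T z) - blinfun_apply (f i) (blinfun_apply T (x i))) < \<epsilon> / 2"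
    by auto
  have "cmod (blinfun_apply h (blinfun_apply T z) - l) < \<epsilon>"
    using norm_diff_triangle_less[OF zh(3) i(7)] by simp
  with zh(1,2) show ?thesis by blast
qed

section \<open>From exact pairs in subspaces to a weakly null net\<close>

text \<open>
  One more functional \<open>g\<close> cuts the common kernel \<open>M\<close> down by at most one dimension: a vector
  \<open>b\<close> of \<open>M\<close> with \<open>g b \<noteq> 0\<close> makes up for the loss.
\<close>

lemma finite_codim_kernels:
  fixes G :: "('a::complex_normed_vector \<Rightarrow>\<^sub>L complex) set"
  assumes "finite G" "G \<subseteq> dual_space"
  shows "finite_codim_subspace {x. \<forall>g\<in>G. blinfun_apply g x = 0}"
  using assms
proof induction
  case empty
  show ?case
    by (auto simp: finite_codim_subspace_def intro!: exI[of _ "{}"])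
next
  case (insert g G)
  define M where "M = {x. \<forall>g\<in>G. blinfun_apply g x = 0}"
  define N where "N = {x. \<forall>g\<in>insert g G. blinfun_apply g x = 0}"
  have N: "N = {x \<in> M. blinfun_apply g x = 0}" by (auto simp: M_def N_def)
  have g: "blinfun_apply g (c *\<^sub>C x) = c * blinfun_apply g x" for c x
    using insert.prems by (simp add: dual_space_iff)
  obtain B where M: "complex_vector.subspace M" "closed M"
    and B: "finite B" "complex_vector.span (M \<union> B) = UNIV"
    using insert.IH insert.prems unfolding M_def[symmetric] finite_codim_subspace_def by blast
  have "complex_vector.subspace N"
    using M(1) unfolding N complex_vector.subspace_def
    by (simp add: blinfun.zero_right blinfun.add_right g)
  moreover have "closed N"
    unfolding N by (intro closed_Collect_conj closed_Collect_eq continuous_intros) (simp add: M(2))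
  moreover have "\<exists>B. finite B \<and> complex_vector.span (N \<union> B) = UNIV"
  proof (cases "M \<subseteq> N")
    case True
    then have "M = N" using N by blast
    with B show ?thesis by blast
  next
    case False
    then obtain b where b: "b \<in> M" "blinfun_apply g b \<noteq> 0" using N by blast
    have "m \<in> complex_vector.span (N \<union> insert b B)" if "m \<in> M" for m
    proof -
      define c where "c = blinfun_apply g m / blinfun_apply g b"
      have "m - c *\<^sub>C b \<in> N"
        using that b unfolding N
        by (simp add: complex_vector.subspace_diff[OF M(1)] complex_vector.subspace_scale[OF M(1)]
            blinfun.diff_right g c_def)
      then have "(m - c *\<^sub>C b) + c *\<^sub>C b \<in> complex_vector.span (N \<union> insert b B)"
        by (intro complex_vector.span_add complex_vector.span_scale complex_vector.span_base) auto
      then show ?thesis by simp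
    qed
    then have "M \<union> B \<subseteq> complex_vector.span (N \<union> insert b B)"
      by (auto intro: complex_vector.span_base)
    then have "complex_vector.span (M \<union> B) \<subseteq> complex_vector.span (N \<union> insert b B)"
      by (rule complex_vector.span_minimal[OF _ complex_vector.subspace_span])
    with B show ?thesis by (intro exI[of _ "insert b B"]) auto
  qed
  ultimately show ?case
    unfolding N_def[symmetric] finite_codim_subspace_def by blast
qed

text \<open>
  The index type of the net is free here: the conditions depend on the image filter only, and
  this filter is also that of a net over the index type in the definition of \<open>W\<^sub>e\<close>.
\<close>

lemma essential_numerical_rangeI:
  fixes z :: "'i \<Rightarrow> 'a::complex_normed_vector \<times> ('a \<Rightarrow>\<^sub>L complex)"
  assumes net: "net_in D le z Pi_set" and weak: "weakly_tendsto (\<lambda>i. fst (z i)) 0 (tails D le)"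
    and lim: "((\<lambda>i. blinfun_apply (snd (z i)) (blinfun_apply T (fst (z i)))) \<longlongrightarrow> l) (tails D le)"
  shows "l \<in> W\<^sub>e T"
proof -
  obtain D' :: "('a \<times> ('a \<Rightarrow>\<^sub>L complex)) net_index set" and le' z' where z':
    "net_in D' le' z' Pi_set" "filtermap z' (tails D' le') = filtermap z (tails D le)"
    using net_reindex[OF net] by blast
  have transfer: "((\<lambda>i. \<phi> (z' i)) \<longlongrightarrow> c) (tails D' le') \<longleftrightarrow> ((\<lambda>i. \<phi> (z i)) \<longlongrightarrow> c) (tails D le)"
    for \<phi> :: "'a \<times> ('a \<Rightarrow>\<^sub>L complex) \<Rightarrow> complex" and c
    using z'(2) by (metis (no_types) filterlim_filtermap)
  have "weakly_tendsto (\<lambda>i. fst (z' i)) 0 (tails D' le')"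
    using weak transfer[of "\<lambda>p. blinfun_apply g (fst p)" for g]
    by (simp add: weakly_tendsto_def)
  moreover have "((\<lambda>i. blinfun_apply (snd (z' i)) (blinfun_apply T (fst (z' i)))) \<longlongrightarrow> l) (tails D' le')"
    using lim transfer[of "\<lambda>p. blinfun_apply (snd p) (blinfun_apply T (fst p))"] by simp
  ultimately show ?thesis
    using z'(1) unfolding essential_numerical_range_def
    by (intro CollectI exI[of _ D'] exI[of _ le'] exI[of _ "\<lambda>i. fst (z' i)"] exI[of _ "\<lambda>i. snd (z' i)"]) simp
qed

text \<open>
  The net is indexed by pairs of a finite set of functionals and a natural number \<open>n\<close>, ordered
  componentwise. At such an index the vector is annihilated by the functionals and the error is
  below \<open>1 / (n + 1)\<close>.
\<close>

lemma exact_in_subspaces_imp_essential_numerical_range: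
  fixes T :: "'a::complex_normed_vector \<Rightarrow>\<^sub>L 'a"
  assumes ex: "\<And>M \<epsilon>. finite_codim_subspace M \<Longrightarrow> 0 < \<epsilon> \<Longrightarrow>
    \<exists>(x, f)\<in>Pi_set. x \<in> M \<and> cmod (blinfun_apply f (blinfun_apply T x) - l) < \<epsilon>"
  shows "l \<in> W\<^sub>e T"
proof -
  define D :: "(('a \<Rightarrow>\<^sub>L complex) set \<times> nat) set" where "D = {G. finite G \<and> G \<subseteq> dual_space} \<times> UNIV"
  define le :: "('a \<Rightarrow>\<^sub>L complex) set \<times> nat \<Rightarrow> ('a \<Rightarrow>\<^sub>L complex) set \<times> nat \<Rightarrow> bool"
    where "le i j \<longleftrightarrow> fst i \<subseteq> fst j \<and> snd i \<le> snd j" for i j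
  have dir: "directed_set D le"
    unfolding directed_set_def
  proof (intro conjI ballI impI)
    show "D \<noteq> {}" by (auto simp: D_def)
    fix i j assume "i \<in> D" "j \<in> D"
    then show "\<exists>k\<in>D. le i k \<and> le j k"
      by (intro bexI[of _ "(fst i \<union> fst j, max (snd i) (snd j))"]) (auto simp: D_def le_def)
  qed (auto simp: le_def)
  have "\<exists>p. p \<in> Pi_set \<and> (\<forall>g\<in>fst i. blinfun_apply g (fst p) = 0) \<and>
      cmod (blinfun_apply (snd p) (blinfun_apply T (fst p)) - l) < 1 / Suc (snd i)" if "i \<in> D" for i
  proof -
    have "finite_codim_subspace {x. \<forall>g\<in>fst i. blinfun_apply g x = 0}"
      using that by (intro finite_codim_kernels) (auto simp: D_def)
    from ex[OF this, of "1 / Suc (snd i)"] show ?thesis by auto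
  qed
  then obtain z where z: "\<And>i. i \<in> D \<Longrightarrow> z i \<in> Pi_set"
    "\<And>i g. i \<in> D \<Longrightarrow> g \<in> fst i \<Longrightarrow> blinfun_apply g (fst (z i)) = 0"
    "\<And>i. i \<in> D \<Longrightarrow> cmod (blinfun_apply (snd (z i)) (blinfun_apply T (fst (z i))) - l) < 1 / Suc (snd i)"
    by metis
  show ?thesis
  proof (rule essential_numerical_rangeI)
    show "net_in D le z Pi_set" using dir z(1) by (simp add: net_in_def)
    show "weakly_tendsto (\<lambda>i. fst (z i)) 0 (tails D le)"
      unfolding weakly_tendsto_def
    proof
      fix g :: "'a \<Rightarrow>\<^sub>L complex" assume "g \<in> dual_space"
      then have "eventually (\<lambda>i. blinfun_apply g (fst (z i)) = 0) (tails D le)"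
        unfolding eventually_tails[OF dir]
        by (intro bexI[of _ "({g}, 0)"]) (auto simp: D_def le_def intro!: z(2))
      then show "((\<lambda>i. blinfun_apply g (fst (z i))) \<longlongrightarrow> blinfun_apply g 0) (tails D le)"
        by (simp add: blinfun.zero_right tendsto_eventually)
    qed
    show "((\<lambda>i. blinfun_apply (snd (z i)) (blinfun_apply T (fst (z i)))) \<longlongrightarrow> l) (tails D le)"
    proof (rule tendstoI)
      fix e :: real assume "0 < e"
      then obtain n where n: "1 / Suc n < e" using nat_approx_posE by blast
      show "eventually (\<lambda>i. dist (blinfun_apply (snd (z i)) (blinfun_apply T (fst (z i)))) l < e) (tails D le)"
        unfolding eventually_tails[OF dir]
      proof (intro bexI[of _ "({}, n)"] ballI impI)
        fix j assume j: "j \<in> D" "le ({}, n) j"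
        have "1 / Suc (snd j) \<le> 1 / Suc n" using j(2) by (simp add: le_def frac_le)
        then show "dist (blinfun_apply (snd (z j)) (blinfun_apply T (fst (z j)))) l < e"
          using z(3)[OF j(1)] n by (simp add: dist_norm)
      qed (simp add: D_def)
    qed
  qed
qed

section \<open>Characterisations of the essential numerical range\<close>

theorem theorem1p9:
  fixes T :: "'a::complex_banach \<Rightarrow>\<^sub>L 'a" and l :: complex
  assumes "T \<in> cblinfun"
  shows
    "(l \<in> W\<^sub>e T \<longleftrightarrow>
      (\<exists>(D :: ('a \<times> ('a \<Rightarrow>\<^sub>L complex)) net_index set) le x f.
        net_in D le (\<lambda>i. (x i, f i)) (UNIV \<times> dual_space) \<and>
        weakly_tendsto x 0 (tails D le) \<and>
        ((\<lambda>i. norm (x i)) \<longlongrightarrow> 1) (tails D le) \<and>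
        ((\<lambda>i. norm (f i)) \<longlongrightarrow> 1) (tails D le) \<and>
        ((\<lambda>i. blinfun_apply (f i) (x i)) \<longlongrightarrow> 1) (tails D le) \<and>
        ((\<lambda>i. blinfun_apply (f i) (blinfun_apply T (x i))) \<longlongrightarrow> l) (tails D le)))
    \<and> (l \<in> W\<^sub>e T \<longleftrightarrow>
      (\<forall>M \<epsilon>. finite_codim_subspace M \<longrightarrow> (\<epsilon>::real) > 0 \<longrightarrow>
        (\<exists>(x, f) \<in> Pi_set. x \<in> M \<and>
          cmod (blinfun_apply f (blinfun_apply T x) - l) < \<epsilon>)))"
    (is "(?i \<longleftrightarrow> ?ii) \<and> (?i \<longleftrightarrow> ?iii)")
proof -
  have "?ii" if i: "?i"
  proof -
    obtain D :: "('a \<times> ('a \<Rightarrow>\<^sub>L complex)) net_index set" and le x f where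
      net: "net_in D le (\<lambda>i. (x i, f i)) Pi_set" and weak: "weakly_tendsto x 0 (tails D le)"
      and lim: "((\<lambda>i. blinfun_apply (f i) (blinfun_apply T (x i))) \<longlongrightarrow> l) (tails D le)"
      using i unfolding essential_numerical_range_def by blast
    have ev: "eventually (\<lambda>i. norm (x i) = 1 \<and> norm (f i) = 1 \<and> blinfun_apply (f i) (x i) = 1) (tails D le)"
      using eventually_net_in[OF net] by eventually_elim (simp add: Pi_set_def)
    have "net_in D le (\<lambda>i. (x i, f i)) (UNIV \<times> dual_space)"
      using net by (auto simp: net_in_def Pi_set_def)
    moreover have "((\<lambda>i. norm (x i)) \<longlongrightarrow> 1) (tails D le)" "((\<lambda>i. norm (f i)) \<longlongrightarrow> 1) (tails D le)"
      "((\<lambda>i. blinfun_apply (f i) (x i)) \<longlongrightarrow> 1) (tails D le)"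
      using ev by (auto intro!: tendsto_eventually elim: eventually_mono)
    ultimately show ?thesis using weak lim by blast
  qed
  moreover have "?iii" if ii: "?ii"
  proof -
    obtain D :: "('a \<times> ('a \<Rightarrow>\<^sub>L complex)) net_index set" and le x f where
      net: "net_in D le (\<lambda>i. (x i, f i)) (UNIV \<times> dual_space)"
      and lims: "weakly_tendsto x 0 (tails D le)"
      "((\<lambda>i. norm (x i)) \<longlongrightarrow> 1) (tails D le)" "((\<lambda>i. norm (f i)) \<longlongrightarrow> 1) (tails D le)"
      "((\<lambda>i. blinfun_apply (f i) (x i)) \<longlongrightarrow> 1) (tails D le)"
      "((\<lambda>i. blinfun_apply (f i) (blinfun_apply T (x i))) \<longlongrightarrow> l) (tails D le)"
      using ii by blast
    have "tails D le \<noteq> bot" using net by (simp add: net_in_def tails_neq_bot)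
    moreover have "eventually (\<lambda>i. f i \<in> dual_space) (tails D le)"
      using eventually_net_in[OF net] by simp
    ultimately show ?thesis
      using almost_norming_imp_exact_in_subspace[OF assms _ _ lims] by blast
  qed
  moreover have "?i" if "?iii"
    using exact_in_subspaces_imp_essential_numerical_range that by blast
  ultimately show ?thesis by blast
qed

end
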